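(* Assume Dickson's Conjecture. Let $({}^*\mathbb{Z}, <, +, \times, 0, 1)$ be a proper elementary extension of $(\mathbb{Z}, <, +, \times, 0, 1)$. Then there exists $\omega \in {}^*\mathbb{Z} \setminus \mathbb{Z}$ such that every element of the galaxy $\mathbf{G}(\omega) = \{\omega - s \mid s \in {}^*\mathbb{Z} \text{ limited}\}$ factors as $\omega - s = a_s \cdot \pi_s$ where $a_s \in \mathbb{Z}$ and $\pi_s \in {}^*\mathbb{Z}$ is an unlimited prime number. Moreover, such an $\omega$ exists for which the coefficients $a_s$ ($s\in\mathbb{Z}$) are the specific integers $a_s$ defined in the context, and for which $\mathbf{G}(\omega)$ contains a unique prime number, namely $\omega = \pi_0$.
   Context: Dickson's Conjecture is the following statement: Let $\ell \ge 1$ and $f_i(x) = c_i + b_i x$ with $c_i, b_i$ integers, $b_i \ge 1$ ($i = 1, \ldots, \ell$). If there is no integer $n > 1$ that divides $\prod_{i=1}^{\ell} f_i(k)$ for every integer $k$, then there exist infinitely many natural numbers $m$ such that all the numbers $f_1(m), \ldots, f_\ell(m)$ are prime. An element of ${}^*\mathbb{Z}$ is limited if its absolute value is bounded by an element of $\mathbb{Z}$ (equivalently, it belongs to $\mathbb{Z}$), and unlimited otherwise. A prime number in ${}^*\mathbb{Z}$ is an element satisfying in ${}^*\mathbb{Z}$ the first-order definition of a (positive) prime number. The specific integers $a_s$: for a prime $p > 2$ and an integer $n \ge 0$ let $s(p,n) = (p^n+1)/2$; let $s(2,n) = (1-(-2)^n)/3 = \sum_{i=0}^{n-1} (-2)^i$.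 For $s \in \mathbb{Z}$ and $p$ prime, let $n_p(s)$ be the highest exponent $n \ge 0$ for which $s \equiv s(p,n) \bmod p^n$ (this exists for all $p$ and $s$, and for each $s$ one has $n_p(s) = 0$ for all sufficiently large $p$). Put $a_s = \prod_p p^{n_p(s)}$, the product being over all primes $p$. In particular $a_0 = 1$. *)

theory Defs
  imports "HOL-Number_Theory.Number_Theory"
begin

section \<open>First-order logic over the signature of ordered rings\<close>

datatype tm = Var nat | Zero | One | Add tm tm | Mul tm tm

datatype fm = Eq tm tm | Less tm tm | Neg fm | Conj fm fm | Ex nat fm

text \<open>The syntactic type classes below carry no axioms: they are exactly an interpretation of the
  signature on the universe \<open>UNIV\<close> of a type (with \<open>\<le>\<close> left unused).\<close>

primrec eval_tm :: "(nat \<Rightarrow> 'a) \<Rightarrow> tm \<Rightarrow> 'a::{ord,plus,times,zero,one}" where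
  "eval_tm e (Var i) = e i"
| "eval_tm e Zero = 0"
| "eval_tm e One = 1"
| "eval_tm e (Add t u) = eval_tm e t + eval_tm e u"
| "eval_tm e (Mul t u) = eval_tm e t * eval_tm e u"

primrec sat :: "(nat \<Rightarrow> 'a::{ord,plus,times,zero,one}) \<Rightarrow> fm \<Rightarrow> bool" where
  "sat e (Eq t u) \<longleftrightarrow> eval_tm e t = eval_tm e u"
| "sat e (Less t u) \<longleftrightarrow> eval_tm e t < eval_tm e u"
| "sat e (Neg A) \<longleftrightarrow> \<not> sat e A"
| "sat e (Conj A B) \<longleftrightarrow> sat e A \<and> sat e B"
| "sat e (Ex i A) \<longleftrightarrow> (\<exists>x. sat (e(i := x)) A)"

definition elementary_embedding ::
  "('a::{ord,plus,times,zero,one} \<Rightarrow> 'b::{ord,plus,times,zero,one}) \<Rightarrow> bool" where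
  "elementary_embedding j \<longleftrightarrow> (\<forall>A e. sat e A \<longleftrightarrow> sat (j \<circ> e) A)"

text \<open>An elementary extension of \<open>(\<int>, <, +, \<times>, 0, 1)\<close> satisfies the axioms of ordered integral
  domains, so it is an instance of \<^class>\<open>linordered_idom\<close> (negation, absolute value and sign being
  definable). The following lemma shows that the embedding of the integers into it is then
  necessarily \<^const>\<open>of_int\<close>, with range \<open>\<int>\<close>.\<close>

lemma elementary_embedding_int_unique:
  fixes j :: "int \<Rightarrow> 'a::linordered_idom"
  assumes "elementary_embedding j"
  shows "j = of_int"
proof
  have el: "sat e A \<longleftrightarrow> sat (j \<circ> e) A" for e A
    using assms unfolding elementary_embedding_def by blast
  have one: "j 1 = 1"
    using el[of "\<lambda>_. 1" "Eq (Var 0) One"] by simp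
  have zero: "j 0 = 0"
    using el[of "\<lambda>_. 0" "Eq (Var 0) Zero"] by simp
  have add: "j (x + y) = j x + j y" for x y
    using el[of "(\<lambda>_. 0)(0 := x + y, 1 := x, 2 := y)" "Eq (Var 0) (Add (Var 1) (Var 2))"] by simp
  fix x show "j x = of_int x"
  proof (induction x rule: int_induct[where k = 0])
    case (step2 i)
    then show ?case using add[of "i - 1" 1] one by (simp add: algebra_simps)
  qed (simp_all add: zero one add)
qed

text \<open>\<open>x\<^sub>0 > 1\<close>, and \<open>x\<^sub>0\<close> is not a product of two elements greater than \<open>1\<close>.\<close>

definition prime_fm :: fm where
  "prime_fm = Conj (Less One (Var 0))
     (Neg (Ex 1 (Ex 2 (Conj (Conj (Less One (Var 1)) (Less One (Var 2)))
                            (Eq (Var 0) (Mul (Var 1) (Var 2)))))))"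

definition fo_prime :: "'a::{ord,plus,times,zero,one} \<Rightarrow> bool" where
  "fo_prime p \<longleftrightarrow> sat (\<lambda>_. p) prime_fm"

lemma fo_prime_iff:
  "fo_prime p \<longleftrightarrow> 1 < p \<and> \<not> (\<exists>a b. 1 < a \<and> 1 < b \<and> p = a * b)"
  by (simp add: fo_prime_def prime_fm_def)

lemma fo_prime_int_iff:
  fixes p :: int
  shows "fo_prime p \<longleftrightarrow> prime p"
proof
  assume L: "fo_prime p"
  have "m = 1 \<or> m = p" if "0 \<le> m" "m dvd p" for m
  proof -
    from that(2) obtain k where k: "p = m * k" ..
    have "1 < p" using L by (simp add: fo_prime_iff)
    with k \<open>0 \<le> m\<close> have "0 < m" "0 < k" by (smt (verit) zero_less_mult_iff)+
    moreover have "\<not> (1 < m \<and> 1 < k)" using L k by (auto simp: fo_prime_iff)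
    ultimately have "m = 1 \<or> k = 1" by linarith
    then show ?thesis using k by auto
  qed
  then show "prime p" using L by (auto simp: prime_int_iff fo_prime_iff)
next
  assume R: "prime p"
  have False if "1 < a" "1 < b" "p = a * b" for a b
  proof -
    have "a dvd p" using that by simp
    moreover have "0 \<le> a" using that by simp
    ultimately have "a = 1 \<or> a = p" using R unfolding prime_int_iff by blast
    then show False using that by auto
  qed
  then show "fo_prime p" using R by (auto simp: fo_prime_iff prime_gt_1_int)
qed

section \<open>Galaxies\<close>

definition limited :: "'a::linordered_idom \<Rightarrow> bool" where
  "limited x \<longleftrightarrow> (\<exists>n::int. \<bar>x\<bar> \<le> of_int n)"

definition galaxy :: "'a::linordered_idom \<Rightarrow> 'a set" where
  "galaxy \<omega> = {\<omega> - s | s. limited s}"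

section \<open>Dickson's Conjecture\<close>

definition dickson_conjecture :: bool where
  "dickson_conjecture \<longleftrightarrow>
     (\<forall>(l::nat) (b :: nat \<Rightarrow> int) (c :: nat \<Rightarrow> int).
        l \<ge> 1 \<longrightarrow> (\<forall>i\<in>{1..l}. b i \<ge> 1) \<longrightarrow>
        \<not> (\<exists>n::int. n > 1 \<and> (\<forall>k::int. n dvd (\<Prod>i=1..l. c i + b i * k))) \<longrightarrow>
        infinite {m::nat. \<forall>i\<in>{1..l}. prime (c i + b i * int m)})"

section \<open>The coefficients\<close>

text \<open>Both divisions are exact (the first one for odd \<open>p\<close>).\<close>

definition residue_rep :: "nat \<Rightarrow> nat \<Rightarrow> int" where
  "residue_rep p n = (if p = 2 then (1 - (-2) ^ n) div 3 else (int p ^ n + 1) div 2)"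

definition coeff_exp :: "nat \<Rightarrow> int \<Rightarrow> nat" where
  "coeff_exp p s = (GREATEST n. [s = residue_rep p n] (mod int p ^ n))"

text \<open>The product ranges over the primes with nonzero exponent, as \<^const>\<open>prod\<close> over an infinite
  set would be \<open>1\<close>.\<close>

definition galaxy_coeff :: "int \<Rightarrow> int" where
  "galaxy_coeff s = (\<Prod>p | prime p \<and> coeff_exp p s \<noteq> 0. int p ^ coeff_exp p s)"

lemma residue_rep_two: "3 * residue_rep 2 n = 1 - (-2) ^ n"
proof -
  have "(3::int) dvd 1 - (-2) ^ n"
  proof -
    have "[(-2) ^ n = (1::int) ^ n] (mod 3)" by (rule cong_pow) (simp add: cong_def)
    then show ?thesis by (metis cong_iff_dvd_diff cong_sym power_one)
  qed
  then show ?thesis by (simp add: residue_rep_def)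
qed

lemma residue_rep_two_sum: "residue_rep 2 n = (\<Sum>i<n. (-2) ^ i)"
proof -
  have "3 * (\<Sum>i<n. (-2::int) ^ i) = 1 - (-2) ^ n"
    by (induction n) (simp_all add: algebra_simps)
  then show ?thesis using residue_rep_two[of n] by simp
qed

lemma residue_rep_odd: "odd p \<Longrightarrow> 2 * residue_rep p n = int p ^ n + 1"
proof -
  assume p: "odd p"
  then have "2 dvd int p ^ n + 1" by simp
  moreover have "p \<noteq> 2" using p by auto
  ultimately show ?thesis unfolding residue_rep_def by (simp only: if_False dvd_mult_div_cancel)
qed

lemma residue_cong_two:
  "[s = residue_rep 2 n] (mod int 2 ^ n) \<longleftrightarrow> 2 ^ n dvd 3 * s - 1"
proof -
  have cop: "coprime ((2::int) ^ n) 3" by simp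
  have "[s = residue_rep 2 n] (mod int 2 ^ n) \<longleftrightarrow> 2 ^ n dvd s - residue_rep 2 n"
    by (simp add: cong_iff_dvd_diff)
  also have "\<dots> \<longleftrightarrow> 2 ^ n dvd 3 * (s - residue_rep 2 n)"
    using coprime_dvd_mult_right_iff[OF cop] by blast
  also have "3 * (s - residue_rep 2 n) = (3 * s - 1) + (-2) ^ n"
    using residue_rep_two[of n] by (simp add: algebra_simps)
  also have "2 ^ n dvd \<dots> \<longleftrightarrow> 2 ^ n dvd 3 * s - 1"
  proof (rule dvd_add_left_iff)
    show "(2::int) ^ n dvd (-2) ^ n"
      by (simp add: power_minus[of "2::int"])
  qed
  finally show ?thesis .
qed

lemma residue_cong_odd:
  assumes "odd p"
  shows "[s = residue_rep p n] (mod int p ^ n) \<longleftrightarrow> int p ^ n dvd 2 * s - 1"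
proof -
  have cop: "coprime (int p ^ n) 2" using assms by simp
  have "[s = residue_rep p n] (mod int p ^ n) \<longleftrightarrow> int p ^ n dvd s - residue_rep p n"
    by (simp add: cong_iff_dvd_diff)
  also have "\<dots> \<longleftrightarrow> int p ^ n dvd 2 * (s - residue_rep p n)"
    using coprime_dvd_mult_right_iff[OF cop] by blast
  also have "2 * (s - residue_rep p n) = (2 * s - 1) - int p ^ n"
    using residue_rep_odd[OF assms, of n] by (simp add: algebra_simps)
  also have "int p ^ n dvd \<dots> \<longleftrightarrow> int p ^ n dvd 2 * s - 1"
    by (simp add: dvd_diff_left_iff)
  finally show ?thesis .
qed

lemma coeff_exp_eq:
  assumes "prime p"
  shows "coeff_exp p s = multiplicity (int p) (if p = 2 then 3 * s - 1 else 2 * s - 1)"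
    (is "_ = multiplicity _ ?t")
proof -
  have t: "?t \<noteq> 0" by presburger
  have "odd p" if "p \<noteq> 2" using assms that prime_odd_nat[of p] prime_ge_2_nat[of p] by force
  then have "[s = residue_rep p n] (mod int p ^ n) \<longleftrightarrow> int p ^ n dvd ?t" for n
    using residue_cong_two[of s n] residue_cong_odd[of p s n] by auto
  then have iff: "[s = residue_rep p n] (mod int p ^ n) \<longleftrightarrow> n \<le> multiplicity (int p) ?t" for n
    using power_dvd_iff_le_multiplicity[OF t, of "int p" n] prime_gt_1_nat[OF assms] by simp
  show ?thesis unfolding coeff_exp_def by (rule Greatest_equality) (simp_all add: iff)
qed

lemma finite_coeff_support: "finite {p. prime p \<and> coeff_exp p s \<noteq> 0}"
proof -
  have "int p \<in> insert 2 (prime_factors (2 * s - 1))" if "prime p" "coeff_exp p s \<noteq> 0" for p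
  proof (cases "p = 2")
    case False
    then have "multiplicity (int p) (2 * s - 1) \<noteq> 0" using that by (simp add: coeff_exp_eq)
    then have "int p dvd 2 * s - 1" by (metis not_dvd_imp_multiplicity_0)
    moreover have "2 * s - 1 \<noteq> 0" by presburger
    ultimately show ?thesis using that by (simp add: prime_factors_dvd)
  qed simp
  then have "int ` {p. prime p \<and> coeff_exp p s \<noteq> 0} \<subseteq> insert 2 (prime_factors (2 * s - 1))" by blast
  then have "finite (int ` {p. prime p \<and> coeff_exp p s \<noteq> 0})" by (rule finite_subset) simp
  then show ?thesis by (rule finite_imageD) simp
qed

lemma galaxy_coeff_0: "galaxy_coeff 0 = 1"
proof -
  have "coeff_exp p 0 = 0" if "prime p" for p
    using that by (simp add: coeff_exp_eq multiplicity_unit_right)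
  then have "{p. prime p \<and> coeff_exp p 0 \<noteq> 0} = {}" by auto
  then show ?thesis unfolding galaxy_coeff_def by (simp only: prod.empty)
qed

end

theory Submission
  imports Defs
begin

text \<open>Since \<open>a\<^sub>s\<close> is \<open>\<bar>2s - 1\<bar>\<close> times the \<open>2\<close>-part of \<open>3s - 1\<close>, it is first-order definable. Choosing
  \<open>m\<close> close to \<open>1/2\<close> \<open>p\<close>-adically for the small odd primes \<open>p\<close>, and close to \<open>1/3\<close> \<open>2\<close>-adically, forces
  \<open>a\<^sub>s\<close> to divide \<open>m - s\<close> with a quotient free of small primes, for all \<open>\<bar>s\<bar> \<le> N\<close>. A large prime is no
  obstruction either, as \<open>m \<equiv> N + 1\<close> avoids all these \<open>s\<close>. So Dickson's Conjecture makes all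
  quotients prime and large at once. "For every \<open>N\<close> there is such an \<open>m > N\<close>" is one first-order
  sentence; in the extension, apply it to an unlimited \<open>N\<close>. No saturation is needed.\<close>

section \<open>Closed form of the coefficients\<close>

text \<open>By \<open>coeff_exp_eq\<close> the exponent at an odd prime is its multiplicity in 2s -
  1, and the exponent at 2 is the multiplicity of 2 in 3s - 1. Since 2s - 1 is odd, its prime powers
  multiply up to its absolute value.\<close>

lemma galaxy_coeff_eq: "galaxy_coeff s = \<bar>2 * s - 1\<bar> * 2 ^ multiplicity 2 (3 * s - 1)"
proof -
  let ?S = "{p. prime p \<and> coeff_exp p s \<noteq> 0}"
  let ?F = "prime_factors (2 * s - 1)"
  have nz: "2 * s - 1 \<noteq> 0" by presburger
  have not2: "2 \<notin> ?F" by (auto simp: prime_factors_dvd)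
  have prime_nat: "prime (nat q)" "q \<noteq> 2" "0 < q" if "q \<in> ?F" for q
  proof -
    have "prime q" using that by (rule in_prime_factors_imp_prime)
    then show "prime (nat q)" "0 < q" by (simp_all add: prime_gt_0_int)
    show "q \<noteq> 2" using that not2 by blast
  qed
  have sub: "?S \<subseteq> insert 2 (nat ` ?F)"
  proof
    fix p assume p: "p \<in> ?S"
    show "p \<in> insert 2 (nat ` ?F)"
    proof (cases "p = 2")
      case False
      with p have "multiplicity (int p) (2 * s - 1) \<noteq> 0" using coeff_exp_eq[of p s] by auto
      then have "int p dvd 2 * s - 1" by (metis not_dvd_imp_multiplicity_0)
      then have "int p \<in> ?F" using p nz by (simp add: prime_factors_dvd)
      then show ?thesis by (metis image_eqI insertI2 nat_int)
    qed simp
  qed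
  \<comment> \<open>The index set is enlarged so that 2 can be split off even when its exponent is
    0; an added index contributes the factor 1.\<close>
  have "galaxy_coeff s = (\<Prod>p\<in>insert 2 (nat ` ?F). int p ^ coeff_exp p s)"
    unfolding galaxy_coeff_def
  proof (rule prod.mono_neutral_left[OF _ sub])
    have "prime p" if "p \<in> insert 2 (nat ` ?F)" for p using that prime_nat(1) by auto
    then show "\<forall>p\<in>insert 2 (nat ` ?F) - ?S. int p ^ coeff_exp p s = 1" by auto
  qed simp
  also have "\<dots> = 2 ^ coeff_exp 2 s * (\<Prod>p\<in>nat ` ?F. int p ^ coeff_exp p s)"
  proof -
    have "2 \<notin> nat ` ?F"
    proof
      assume "2 \<in> nat ` ?F"
      then obtain q where q: "q \<in> ?F" "2 = nat q" by blast
      then show False using prime_nat(2)[OF q(1)] by linarith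
    qed
    then show ?thesis by simp
  qed
  also have "(\<Prod>p\<in>nat ` ?F. int p ^ coeff_exp p s)
      = (\<Prod>q\<in>?F. int (nat q) ^ coeff_exp (nat q) s)"
  proof -
    have "inj_on nat ?F" using prime_nat(3) by (metis inj_onI int_nat_eq less_imp_le)
    then show ?thesis by (simp add: prod.reindex)
  qed
  also have "\<dots> = (\<Prod>q\<in>?F. q ^ multiplicity q (2 * s - 1))"
  proof (rule prod.cong)
    fix q assume q: "q \<in> ?F"
    have "nat q \<noteq> 2" using prime_nat(2)[OF q] by linarith
    then show "int (nat q) ^ coeff_exp (nat q) s = q ^ multiplicity q (2 * s - 1)"
      using prime_nat[OF q] by (simp add: coeff_exp_eq)
  qed simp
  also have "\<dots> = \<bar>2 * s - 1\<bar>" using prod_prime_factors[OF nz] by simp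
  finally show ?thesis by (simp add: coeff_exp_eq)
qed

lemma galaxy_coeff_pos: "0 < galaxy_coeff s"
proof -
  have "2 * s - 1 \<noteq> 0" by presburger
  then show ?thesis by (simp add: galaxy_coeff_eq)
qed

text \<open>The factor |2s - 1| equals 1 only for s = 0 and s = 1, and at s = 1 the 2-part of 3s - 1
  = 2 supplies a factor 2. This makes the prime in the galaxy unique.\<close>

lemma galaxy_coeff_gt_1:
  assumes "s \<noteq> 0"
  shows "1 < galaxy_coeff s"
proof (cases "s = 1")
  case True
  have "multiplicity 2 (2::int) = 1" by simp
  then show ?thesis using True by (simp add: galaxy_coeff_eq)
next
  case False
  have "1 < \<bar>2 * s - 1\<bar>" using assms False by linarith
  moreover have "(1::int) \<le> 2 ^ multiplicity 2 (3 * s - 1)" by simp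
  ultimately show ?thesis unfolding galaxy_coeff_eq
    by (smt (verit) mult_le_cancel_left1 mult.commute)
qed

section \<open>The consequence of Dickson's Conjecture in the integers\<close>

text \<open>(P + 1)/2 inverts 2 modulo P, and \<open>residue_rep 2 e\<close> inverts 3 modulo 2^e;
  the Chinese remainder theorem combines the two.\<close>

lemma exists_half_third:
  fixes P :: int
  assumes "odd P"
  obtains m where "P dvd 2 * m - 1" "2 ^ e dvd 3 * m - 1"
proof -
  have "coprime P (2 ^ e)" using assms by simp
  then obtain m where m: "[m = (P + 1) div 2] (mod P)" "[m = residue_rep 2 e] (mod 2 ^ e)"
    using binary_chinese_remainder_int by blast
  have "[2 * m = 2 * ((P + 1) div 2)] (mod P)" using m(1) by (rule cong_scalar_left)
  moreover have "2 * ((P + 1) div 2) = P + 1"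
    by (rule dvd_mult_div_cancel) (use assms in simp)
  ultimately have "[2 * m = P + 1] (mod P)" by simp
  then have "P dvd 2 * m - (P + 1)" by (simp add: cong_iff_dvd_diff)
  then have "P dvd (2 * m - (P + 1)) + P" by (rule dvd_add) simp
  then have "P dvd 2 * m - 1" by (simp add: algebra_simps)
  moreover have "2 ^ e dvd 3 * m - 1" using m(2) residue_cong_two[of m e] by simp
  ultimately show ?thesis using that by blast
qed

text \<open>Since (2m - 1) - 2(m - s) = 2s - 1, such a divisor would divide 2s - 1 itself, making p
  a unit. For prime p this keeps p out of the quotient of m - s by 2s - 1.\<close>

lemma not_dvd_half:
  fixes s m p P :: int
  assumes "p * (2 * s - 1) dvd P" "P dvd 2 * m - 1" "\<not> is_unit p"
  shows "\<not> p * (2 * s - 1) dvd m - s"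
proof
  assume *: "p * (2 * s - 1) dvd m - s"
  have "p * (2 * s - 1) dvd 2 * m - 1" using assms(1,2) by (rule dvd_trans)
  then have "p * (2 * s - 1) dvd (2 * m - 1) - 2 * (m - s)"
    using dvd_mult[OF *] by (rule dvd_diff)
  also have "(2 * m - 1) - 2 * (m - s) = 1 * (2 * s - 1)" by simp
  finally have "2 * s - 1 = 0 \<or> p dvd 1" by (simp only: dvd_mult_cancel_right)
  moreover have "2 * s - 1 \<noteq> 0" by presburger
  ultimately show False using assms(3) by blast
qed

text \<open>The bounds put the multiplicity v of 2 in 3s - 1 below e, so 2^(v+1) divides 3m - 1.
  Hence 3(m - s) = (3m - 1) - (3s - 1) has the same 2-adic valuation as 3s - 1.\<close>

lemma two_part_dvd_exactly:
  fixes s m :: int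
  assumes "3 * s - 1 < 2 ^ e" "1 - 3 * s < 2 ^ e" "2 ^ e dvd 3 * m - 1"
  shows "2 ^ multiplicity 2 (3 * s - 1) dvd m - s"
    and "\<not> 2 * 2 ^ multiplicity 2 (3 * s - 1) dvd m - s"
proof -
  let ?v = "multiplicity 2 (3 * s - 1)"
  have nz: "3 * s - 1 \<noteq> 0" by presburger
  have "2 ^ ?v dvd 3 * s - 1" by (rule multiplicity_dvd)
  then have "2 ^ ?v \<le> \<bar>3 * s - 1\<bar>" using dvd_imp_le_int[OF nz] by fastforce
  then have "(2::int) ^ ?v < 2 ^ e" using assms(1,2) by linarith
  then have "Suc ?v \<le> e" by (simp add: Suc_le_eq)
  then have "2 ^ Suc ?v dvd (2::int) ^ e" by (rule le_imp_power_dvd)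
  then have d: "2 ^ Suc ?v dvd 3 * m - 1" using assms(3) by (rule dvd_trans)
  then have "2 ^ ?v dvd 3 * m - 1" by (auto intro: dvd_mult_right)
  then have "2 ^ ?v dvd (3 * m - 1) - (3 * s - 1)" by (rule dvd_diff) (rule multiplicity_dvd)
  also have "(3 * m - 1) - (3 * s - 1) = 3 * (m - s)" by simp
  finally show "2 ^ ?v dvd m - s" by (subst (asm) coprime_dvd_mult_right_iff) auto
  show "\<not> 2 * 2 ^ ?v dvd m - s"
  proof
    assume "2 * 2 ^ ?v dvd m - s"
    then have "2 ^ Suc ?v dvd 3 * (m - s)" unfolding power_Suc by (rule dvd_mult)
    with d have "2 ^ Suc ?v dvd (3 * m - 1) - 3 * (m - s)" by (rule dvd_diff)
    then have "2 ^ Suc ?v dvd 3 * s - 1" by simp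
    moreover have "\<not> is_unit (2::int)" by simp
    ultimately have "Suc ?v \<le> ?v" using nz power_dvd_iff_le_multiplicity by blast
    then show False by simp
  qed
qed

text \<open>Dickson's Conjecture is applied to the 2N + 1 linear forms k \<mapsto> (m0 + B k - s) /
  a_s, one for each |s| <= N.\<close>

lemma dickson_galaxy:
  assumes dickson: dickson_conjecture and N: "0 \<le> N"
  shows "\<exists>m>N. \<forall>s. \<bar>s\<bar> \<le> N \<longrightarrow> (\<exists>q. prime q \<and> N < q \<and> m - s = galaxy_coeff s * q)"
proof -
  \<comment> \<open>\<open>R\<close> is a multiple of every 2s - 1 with |s| <= N and of every odd
    prime up to 2N + 1. It enters \<open>B\<close> squared so that p(2s - 1) divides it even when p
    divides 2s - 1. The exponent \<open>e\<close> makes 2^e exceed every |3s - 1|.\<close>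
  define R where "R = \<Prod>{x \<in> {1..2 * N + 1}. odd x}"
  have finite: "finite {x \<in> {1..2 * N + 1}. odd x}"
    by (rule finite_subset[of _ "{1..2 * N + 1}"]) auto
  define e where "e = nat (3 * N + 1)"
  define B where "B = R\<^sup>2 * 2 ^ e"
  have R_dvd: "x dvd R" if "odd x" "\<bar>x\<bar> \<le> 2 * N + 1" for x
  proof -
    have "x \<noteq> 0" using that(1) by auto
    then have "\<bar>x\<bar> \<in> {x. x \<in> {1..2 * N + 1} \<and> odd x}" using that by auto
    then have "\<bar>x\<bar> dvd R" unfolding R_def by (rule dvd_prodI[OF finite])
    then show ?thesis by simp
  qed
  have R_odd: "odd R" unfolding R_def by (subst even_prod_iff[OF finite]) auto
  have "0 < R" unfolding R_def by (rule prod_pos) auto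
  then have B_pos: "0 < B" unfolding B_def by simp
  have e: "3 * N + 1 < 2 ^ e"
    using of_nat_less_two_power[of e, where 'a = int] N by (simp add: e_def)
  obtain m0 where m0: "R\<^sup>2 dvd 2 * m0 - 1" "2 ^ e dvd 3 * m0 - 1"
    using exists_half_third[of "R\<^sup>2" e] R_odd by auto
  have m: "R\<^sup>2 dvd 2 * (m0 + B * k) - 1" "2 ^ e dvd 3 * (m0 + B * k) - 1" for k
  proof -
    have "R\<^sup>2 dvd (2 * m0 - 1) + 2 * (B * k)" using m0(1) by (rule dvd_add) (simp add: B_def)
    then show "R\<^sup>2 dvd 2 * (m0 + B * k) - 1" by (simp add: algebra_simps)
    have "2 ^ e dvd (3 * m0 - 1) + 3 * (B * k)" using m0(2) by (rule dvd_add) (simp add: B_def)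
    then show "2 ^ e dvd 3 * (m0 + B * k) - 1" by (simp add: algebra_simps)
  qed
  have s_bound: "odd (2 * s - 1)" "\<bar>2 * s - 1\<bar> \<le> 2 * N + 1" "3 * s - 1 < 2 ^ e" "1 - 3 * s < 2 ^ e"
    if "\<bar>s\<bar> \<le> N" for s
    using that e by auto
  have dvd: "galaxy_coeff s dvd m0 + B * k - s" if s: "\<bar>s\<bar> \<le> N" for s k
  proof -
    have "2 * s - 1 dvd R" using s_bound[OF s] by (intro R_dvd)
    then have "2 * s - 1 dvd R\<^sup>2" by (simp add: power2_eq_square)
    then have "2 * s - 1 dvd 2 * (m0 + B * k) - 1" using m(1) by (rule dvd_trans)
    then have "2 * s - 1 dvd (2 * (m0 + B * k) - 1) - (2 * s - 1)" by (rule dvd_diff) simp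
    also have "(2 * (m0 + B * k) - 1) - (2 * s - 1) = 2 * (m0 + B * k - s)" by simp
    finally have "2 * s - 1 dvd m0 + B * k - s"
      using s_bound(1)[OF s] by (subst (asm) coprime_dvd_mult_right_iff) auto
    then have "\<bar>2 * s - 1\<bar> dvd m0 + B * k - s" by simp
    moreover have "2 ^ multiplicity 2 (3 * s - 1) dvd m0 + B * k - s"
      using s_bound[OF s] m(2) by (intro two_part_dvd_exactly)
    moreover have "coprime \<bar>2 * s - 1\<bar> (2 ^ multiplicity 2 (3 * s - 1))" by simp
    ultimately show ?thesis unfolding galaxy_coeff_eq by (rule divides_mult)
  qed
  have coeff_dvd_B: "galaxy_coeff s dvd B" if s: "\<bar>s\<bar> \<le> N" for s
  proof -
    \<comment> \<open>\<open>B\<close> is the difference of the values at k = 1 and k = 0, both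
      divisible by a_s.\<close>
    have "galaxy_coeff s dvd (m0 + B * 1 - s) - (m0 + B * 0 - s)"
      using dvd[OF s] dvd[OF s] by (rule dvd_diff)
    then show ?thesis by simp
  qed
  \<comment> \<open>No small prime divides any quotient, whatever k is. The prime 2 is listed
    separately because it exceeds 2N + 1 when N = 0.\<close>
  have not_dvd: "\<not> p * galaxy_coeff s dvd m0 + B * k - s"
    if s: "\<bar>s\<bar> \<le> N" and p: "prime p" "p \<le> 2 * N + 1 \<or> p = 2" for s k p
  proof (cases "p = 2")
    case True
    have "\<not> 2 * 2 ^ multiplicity 2 (3 * s - 1) dvd m0 + B * k - s"
      using s_bound[OF s] m(2) by (intro two_part_dvd_exactly)
    moreover have "2 * 2 ^ multiplicity 2 (3 * s - 1) dvd p * galaxy_coeff s"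
      unfolding galaxy_coeff_eq True by simp
    ultimately show ?thesis using dvd_trans by blast
  next
    case False
    then have "odd p" using p(1) prime_ge_2_int[OF p(1)] by (intro prime_odd_int) auto
    then have "p dvd R" using p False prime_gt_0_int[OF p(1)] by (intro R_dvd) auto
    moreover have "2 * s - 1 dvd R" using s_bound[OF s] by (intro R_dvd)
    ultimately have "p * (2 * s - 1) dvd R\<^sup>2" unfolding power2_eq_square by (rule mult_dvd_mono)
    then have "\<not> p * (2 * s - 1) dvd m0 + B * k - s"
      using m(1) by (rule not_dvd_half) (use p(1) in auto)
    moreover have "p * (2 * s - 1) dvd p * galaxy_coeff s"
      unfolding galaxy_coeff_eq by (intro mult_dvd_mono) auto
    ultimately show ?thesis using dvd_trans by blast
  qed
  \<comment> \<open>The indices 1, ..., l enumerate s = -N, ..., N through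
    \<open>shift\<close>.\<close>
  define l where "l = nat (2 * N + 1)"
  define shift where "shift i = int i - N - 1" for i
  define b where "b i = B div galaxy_coeff (shift i)" for i
  define c where "c i = (m0 - shift i) div galaxy_coeff (shift i)" for i
  have shift: "\<bar>shift i\<bar> \<le> N" if "i \<in> {1..l}" for i
    using that N by (auto simp: shift_def l_def)
  have f: "galaxy_coeff (shift i) * (c i + b i * k) = m0 + B * k - shift i" if i: "i \<in> {1..l}" for i k
  proof -
    have "galaxy_coeff (shift i) * b i = B"
      unfolding b_def using coeff_dvd_B[OF shift[OF i]] by simp
    moreover have "galaxy_coeff (shift i) * c i = m0 - shift i"
      unfolding c_def using dvd[OF shift[OF i], of 0] by simp
    ultimately show ?thesis by (simp add: algebra_simps)
  qed
  have b_pos: "1 \<le> b i" if i: "i \<in> {1..l}" for i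
  proof -
    have "galaxy_coeff (shift i) * b i = B"
      unfolding b_def using coeff_dvd_B[OF shift[OF i]] by simp
    then show ?thesis using B_pos galaxy_coeff_pos[of "shift i"]
      by (smt (verit) mult_pos_neg mult_eq_0_iff)
  qed
  have no_obstruction: "\<not> (\<exists>n::int. n > 1 \<and> (\<forall>k::int. n dvd (\<Prod>i=1..l. c i + b i * k)))"
  proof
    assume "\<exists>n::int. n > 1 \<and> (\<forall>k::int. n dvd (\<Prod>i=1..l. c i + b i * k))"
    then obtain n :: int where n: "n > 1" "\<And>k. n dvd (\<Prod>i=1..l. c i + b i * k)" by blast
    obtain p where p: "prime p" "p dvd n" using n(1) prime_factor_int[of n] by auto
    \<comment> \<open>A prime that divides the product for every k divides, for each k, one of the
      forms.\<close>
    have ex: "\<exists>i\<in>{1..l}. p * galaxy_coeff (shift i) dvd m0 + B * k - shift i" for k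
    proof -
      have "p dvd (\<Prod>i=1..l. c i + b i * k)" using p(2) n(2) by (rule dvd_trans)
      then obtain i where i: "i \<in> {1..l}" "p dvd c i + b i * k"
        using p(1) by (auto simp: prime_dvd_prod_iff)
      have "p * galaxy_coeff (shift i) dvd (c i + b i * k) * galaxy_coeff (shift i)"
        using i(2) by (rule mult_dvd_mono) simp
      then show ?thesis using f[OF i(1), of k] i(1) by (metis mult.commute)
    qed
    show False
    proof (cases "p \<le> 2 * N + 1 \<or> p = 2")
      case True
      then show False using ex[of 0] not_dvd p(1) shift by blast
    next
      case False
      have "\<not> p dvd B"
      proof
        assume "p dvd B"
        then have "p dvd R\<^sup>2 \<or> p dvd 2 ^ e" unfolding B_def using p(1) by (simp add: prime_dvd_mult_iff)
        then have "p dvd R \<or> p dvd 2" using p(1) prime_dvd_power by blast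
        moreover have "\<not> p dvd 2"
          using False prime_ge_2_int[OF p(1)] by (auto dest: zdvd_imp_le)
        ultimately have "p dvd R" by blast
        then obtain x where "x \<in> {1..2 * N + 1}" "p dvd x"
          unfolding R_def using p(1) by (subst (asm) prime_dvd_prod_iff[OF finite]) auto
        then show False using False by (auto dest: zdvd_imp_le)
      qed
      \<comment> \<open>As \<open>B\<close> is invertible modulo the large prime p, some k makes m0
        + B k congruent to N + 1. Then p would have to divide some N + 1 - s, which lies between 1
        and 2N + 1 < p.\<close>
      then have "coprime B p" using p(1) prime_imp_coprime coprime_commute by blast
      then obtain u where "[B * u = 1] (mod p)" using cong_solve_coprime_int by blast
      then have "[B * u * (N + 1 - m0) = 1 * (N + 1 - m0)] (mod p)" by (rule cong_scalar_right)
      then have k: "p dvd B * (u * (N + 1 - m0)) - (N + 1 - m0)"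
        by (simp add: cong_iff_dvd_diff mult.assoc)
      obtain i where i: "i \<in> {1..l}"
          "p * galaxy_coeff (shift i) dvd m0 + B * (u * (N + 1 - m0)) - shift i"
        using ex by blast
      from i(2) have "p dvd m0 + B * (u * (N + 1 - m0)) - shift i" by (rule dvd_mult_left)
      from dvd_diff[OF this k] have "p dvd N + 1 - shift i" by (simp add: algebra_simps)
      moreover have "0 < N + 1 - shift i" "N + 1 - shift i \<le> 2 * N + 1"
        using shift[OF i(1)] by auto
      ultimately show False using False by (auto dest: zdvd_imp_le)
    qed
  qed
  have "1 \<le> l" using N by (simp add: l_def)
  then have inf: "infinite {k::nat. \<forall>i\<in>{1..l}. prime (c i + b i * int k)}"
    using dickson b_pos no_obstruction unfolding dickson_conjecture_def by blast
  \<comment> \<open>The bound on k makes the primes large: |c_i| <= |m0 - s| <= |m0| + N and b_i >=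
    1, so c_i + b_i k > N.\<close>
  then obtain k :: nat where k: "nat (\<bar>m0\<bar> + 2 * N) < k" "\<And>i. i \<in> {1..l} \<Longrightarrow> prime (c i + b i * int k)"
    unfolding infinite_nat_iff_unbounded by blast
  have k_less: "\<bar>m0\<bar> + 2 * N < int k" using k(1) by linarith
  have le_mult: "int k \<le> x * int k" if "1 \<le> x" for x
    using that mult_right_mono[of 1 x "int k"] by simp
  show ?thesis
  proof (rule exI[of _ "m0 + B * int k"], intro conjI allI impI)
    show "N < m0 + B * int k" using le_mult[of B] B_pos k_less N by linarith
    fix s assume s: "\<bar>s\<bar> \<le> N"
    define i where "i = nat (s + N + 1)"
    have i: "i \<in> {1..l}" "shift i = s" using s by (auto simp: i_def l_def shift_def)
    have "\<bar>c i\<bar> \<le> \<bar>m0 - s\<bar>"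
    proof -
      have "galaxy_coeff s * c i = m0 - s" using f[OF i(1), of 0] i(2) by simp
      moreover have "\<bar>c i\<bar> * 1 \<le> \<bar>c i\<bar> * galaxy_coeff s"
        using galaxy_coeff_pos[of s] by (intro mult_left_mono) auto
      ultimately show ?thesis using galaxy_coeff_pos[of s]
        by (metis abs_mult abs_of_pos mult.commute mult.right_neutral)
    qed
    then have "N < c i + b i * int k" using le_mult[OF b_pos[OF i(1)]] k_less s by linarith
    then show "\<exists>q. prime q \<and> N < q \<and> m0 + B * int k - s = galaxy_coeff s * q"
      using k(2)[OF i(1)] f[OF i(1), of "int k"] i(2) by metis
  qed
qed

section \<open>First-order definability of the coefficients\<close>

text \<open>A power of two is recognised, without exponentiation, by all its divisors greater than \<open>1\<close>
  being even.\<close>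

definition coeff_rel :: "'a::{ord,plus,times,zero,one} \<Rightarrow> 'a \<Rightarrow> bool" where
  "coeff_rel s a \<longleftrightarrow> (\<exists>u d v. (u + 1 = s + s \<or> u + (s + s) = 1) \<and> 0 < u \<and> 0 < d \<and>
     s + (s + s) = d * (v + (v + 1)) + 1 \<and>
     (\<forall>x y. 1 < x \<and> d = x * y \<longrightarrow> (\<exists>z. x = z + z)) \<and> a = u * d)"

abbreviation (input) Disj :: "fm \<Rightarrow> fm \<Rightarrow> fm" where "Disj A B \<equiv> Neg (Conj (Neg A) (Neg B))"
abbreviation (input) Imp :: "fm \<Rightarrow> fm \<Rightarrow> fm" where "Imp A B \<equiv> Neg (Conj A (Neg B))"
abbreviation (input) All :: "nat \<Rightarrow> fm \<Rightarrow> fm" where "All i A \<equiv> Neg (Ex i (Neg A))"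

text \<open>The free variables are 3 for s and 4 for the coefficient. The bound ones start at 5,
  clear of the variables 0 to 4 of the surrounding \<open>galaxy_fm\<close>.\<close>

definition coeff_fm :: fm where
  "coeff_fm = (let s = Var 3; a = Var 4; u = Var 5; d = Var 6; v = Var 7; x = Var 8; y = Var 9;
     z = Var 10 in
     Ex 5 (Ex 6 (Ex 7 (Conj (Disj (Eq (Add u One) (Add s s)) (Eq (Add u (Add s s)) One))
       (Conj (Less Zero u) (Conj (Less Zero d)
       (Conj (Eq (Add s (Add s s)) (Add (Mul d (Add v (Add v One))) One))
       (Conj (All 8 (All 9 (Imp (Conj (Less One x) (Eq d (Mul x y))) (Ex 10 (Eq x (Add z z))))))
         (Eq a (Mul u d))))))))))"

lemma sat_coeff_fm: "sat e coeff_fm \<longleftrightarrow> coeff_rel (e 3) (e 4)"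
  by (simp add: coeff_fm_def coeff_rel_def Let_def) blast

lemma sat_prime_fm: "sat e prime_fm \<longleftrightarrow> fo_prime (e 0)"
  by (simp add: fo_prime_def prime_fm_def)

text \<open>The odd part of d is itself a divisor, so it cannot exceed 1.\<close>

lemma power_of_two_if_divisors_even:
  fixes d :: int
  assumes "0 < d" "\<And>x. 1 < x \<Longrightarrow> x dvd d \<Longrightarrow> even x"
  obtains k where "d = 2 ^ k"
proof -
  obtain r where r: "d = 2 ^ multiplicity 2 d * r" "\<not> 2 dvd r"
    using assms(1) multiplicity_decompose'[of d 2] by auto
  have "0 < r" using r(1) assms(1) by (metis zero_less_mult_pos zero_less_numeral zero_less_power)
  moreover have "\<not> 1 < r" using assms(2)[of r] r by (metis dvd_triv_right)
  ultimately have "r = 1" by simp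
  then show ?thesis using r(1) that by simp
qed

text \<open>The witnesses are forced: u = |2s - 1|, and d is the 2-part of 3s - 1, because it is a
  power of two with odd cofactor 2v + 1.\<close>

lemma coeff_rel_int_iff:
  fixes s a :: int
  shows "coeff_rel s a \<longleftrightarrow> a = galaxy_coeff s"
proof
  assume "coeff_rel s a"
  then obtain u d v where *: "u + 1 = s + s \<or> u + (s + s) = 1" "0 < u" "0 < d"
      "s + (s + s) = d * (v + (v + 1)) + 1"
      "\<And>x y. 1 < x \<Longrightarrow> d = x * y \<Longrightarrow> \<exists>z. x = z + z" "a = u * d"
    unfolding coeff_rel_def by blast
  have u: "u = \<bar>2 * s - 1\<bar>" using *(1,2) by auto
  obtain k where k: "d = 2 ^ k"
  proof (rule power_of_two_if_divisors_even[OF *(3)])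
    fix x :: int assume x: "1 < x" "x dvd d"
    then obtain y where "d = x * y" by (auto elim: dvdE)
    then obtain z where "x = z + z" using *(5)[OF x(1)] by blast
    then show "even x" by simp
  qed
  have "multiplicity 2 (3 * s - 1) = k"
  proof (rule multiplicity_eqI)
    have eq: "3 * s - 1 = 2 ^ k * (2 * v + 1)" using *(4) k by (simp add: algebra_simps)
    show "2 ^ k dvd 3 * s - 1" unfolding eq by simp
    show "\<not> 2 ^ Suc k dvd 3 * s - 1" unfolding eq by simp
  qed
  then show "a = galaxy_coeff s" using *(6) u k by (simp add: galaxy_coeff_eq)
next
  assume a: "a = galaxy_coeff s"
  let ?k = "multiplicity 2 (3 * s - 1)"
  have nz: "3 * s - 1 \<noteq> 0" "2 * s - 1 \<noteq> 0" by presburger+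
  then obtain r where r: "3 * s - 1 = 2 ^ ?k * r" "\<not> 2 dvd r"
    using multiplicity_decompose'[of "3 * s - 1" 2] by auto
  then obtain v where v: "r = 2 * v + 1" by (auto elim: oddE)
  have even: "\<exists>z. x = z + z" if x: "1 < x" "2 ^ ?k = x * y" for x y :: int
  proof -
    have "x dvd 2 ^ ?k" using x(2) by simp
    moreover have "prime (2::int)" by simp
    ultimately obtain i where "normalize x = 2 ^ i" using divides_primepow by blast
    then have i: "x = 2 ^ i" using x(1) by simp
    then have "even x" using x(1) by (cases i) auto
    then show ?thesis by (metis evenE mult_2)
  qed
  show "coeff_rel s a" unfolding coeff_rel_def
  proof (intro exI conjI)
    show "\<bar>2 * s - 1\<bar> + 1 = s + s \<or> \<bar>2 * s - 1\<bar> + (s + s) = 1" by linarith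
    show "0 < \<bar>2 * s - 1\<bar>" using nz by simp
    show "0 < (2::int) ^ ?k" by simp
    show "s + (s + s) = 2 ^ ?k * (v + (v + 1)) + 1" using r(1) v by (simp add: algebra_simps)
    show "\<forall>x y. 1 < x \<and> (2::int) ^ ?k = x * y \<longrightarrow> (\<exists>z. x = z + z)" using even by blast
    show "a = \<bar>2 * s - 1\<bar> * 2 ^ ?k" using a by (simp add: galaxy_coeff_eq)
  qed
qed

section \<open>Transfer\<close>

text \<open>Variables 1, 2, 3, 4, 0 stand for N, m, s, the coefficient and the prime. The condition
  |s| <= N becomes s < N + 1 and 0 < s + (N + 1), and m - s = a q becomes m = a q + s, as the
  signature has neither subtraction nor \<le>. That \<open>prime_fm\<close> rebinds 1 and 2 is
  harmless, since only variable 0 is free in it.\<close>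

definition galaxy_fm :: fm where
  "galaxy_fm = All 1 (Ex 2 (Conj (Less (Var 1) (Var 2))
     (All 3 (Imp (Conj (Less (Var 3) (Add (Var 1) One)) (Less Zero (Add (Var 3) (Add (Var 1) One))))
       (Ex 4 (Ex 0 (Conj coeff_fm (Conj prime_fm (Conj (Less (Var 1) (Var 0))
         (Eq (Var 2) (Add (Mul (Var 4) (Var 0)) (Var 3))))))))))))"

lemma sat_galaxy_fm:
  fixes e :: "nat \<Rightarrow> 'a::{ord,plus,times,zero,one}"
  shows "sat e galaxy_fm \<longleftrightarrow> (\<forall>N::'a. \<exists>m>N. \<forall>s. 0 < s + (N + 1) \<longrightarrow> s < N + 1 \<longrightarrow>
     (\<exists>a. coeff_rel s a \<and> (\<exists>q>N. fo_prime q \<and> m = a * q + s)))"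
  by (simp add: galaxy_fm_def sat_coeff_fm sat_prime_fm)

text \<open>The sentence also speaks of negative N, so the integer statement is applied to |N|,
  which covers every required s and strengthens the lower bounds.\<close>

lemma sat_galaxy_fm_int:
  assumes dickson_conjecture
  shows "sat (e :: nat \<Rightarrow> int) galaxy_fm"
  unfolding sat_galaxy_fm
proof
  fix N :: int
  obtain m where m: "m > \<bar>N\<bar>"
      "\<And>s. \<bar>s\<bar> \<le> \<bar>N\<bar> \<Longrightarrow> \<exists>q. prime q \<and> \<bar>N\<bar> < q \<and> m - s = galaxy_coeff s * q"
    using dickson_galaxy[OF assms, of "\<bar>N\<bar>"] by auto
  show "\<exists>m>N. \<forall>s. 0 < s + (N + 1) \<longrightarrow> s < N + 1 \<longrightarrow>
     (\<exists>a. coeff_rel s a \<and> (\<exists>q>N. fo_prime q \<and> m = a * q + s))"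
  proof (rule exI[of _ m], intro conjI allI impI)
    show "N < m" using m(1) by linarith
    fix s assume "0 < s + (N + 1)" "s < N + 1"
    then have "\<bar>s\<bar> \<le> \<bar>N\<bar>" by linarith
    then obtain q where q: "prime q" "\<bar>N\<bar> < q" "m - s = galaxy_coeff s * q" using m(2) by blast
    have "coeff_rel s (galaxy_coeff s)" by (simp add: coeff_rel_int_iff)
    moreover have "fo_prime q" using q(1) by (simp add: fo_prime_int_iff)
    moreover have "N < q" "m = galaxy_coeff s * q + s" using q by linarith+
    ultimately show "\<exists>a. coeff_rel s a \<and> (\<exists>q>N. fo_prime q \<and> m = a * q + s)" by blast
  qed
qed

context
  assumes elementary: "elementary_embedding (of_int :: int \<Rightarrow> 'a::linordered_idom)"
begin

lemma sat_of_int: "sat e A \<Longrightarrow> sat (of_int \<circ> e :: nat \<Rightarrow> 'a) A"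
  using elementary unfolding elementary_embedding_def by blast

text \<open>For a standard s, the uniqueness of the coefficient is transferred, with the integer a_s
  supplied as the parameter \<open>Var 1\<close>.\<close>

lemma coeff_rel_of_int:
  assumes "coeff_rel (of_int s) (x :: 'a)"
  shows "x = of_int (galaxy_coeff s)"
proof -
  let ?e = "(\<lambda>_. 0)(1 := galaxy_coeff s, 3 := s)"
  have "sat ?e (All 4 (Imp coeff_fm (Eq (Var 4) (Var 1))))"
    by (simp add: sat_coeff_fm coeff_rel_int_iff)
  then have "sat (of_int \<circ> ?e :: nat \<Rightarrow> 'a) (All 4 (Imp coeff_fm (Eq (Var 4) (Var 1))))"
    by (rule sat_of_int)
  then show ?thesis using assms by (simp add: sat_coeff_fm)
qed

text \<open>Transfer shows that nothing lies strictly between 0 and 1. Subtracting 1 repeatedly then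
  takes a nonnegative element below a standard bound down to 0.\<close>

lemma limited_imp_of_int:
  assumes "limited (x :: 'a)"
  obtains i where "x = of_int i"
proof -
  have "sat (\<lambda>_. 0::int) (All 0 (Neg (Conj (Less Zero (Var 0)) (Less (Var 0) One))))"
    by simp
  then have "sat (of_int \<circ> (\<lambda>_. 0) :: nat \<Rightarrow> 'a)
      (All 0 (Neg (Conj (Less Zero (Var 0)) (Less (Var 0) One))))"
    by (rule sat_of_int)
  then have discrete: "\<not> (0 < y \<and> y < 1)" for y :: 'a by simp
  have nonneg: "y \<in> \<int>" if "0 \<le> y" "y \<le> of_nat n" for y :: 'a and n
    using that
  proof (induction n arbitrary: y)
    case (Suc n)
    show ?case
    proof (cases "1 \<le> y")
      case True
      then have "y - 1 \<in> \<int>" using Suc by (auto simp: algebra_simps)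
      then show ?thesis by (metis Ints_1 Ints_add diff_add_cancel)
    next
      case False
      then have "y = 0" using Suc.prems(1) discrete[of y] by auto
      then show ?thesis by simp
    qed
  qed simp
  obtain n where "\<bar>x\<bar> \<le> of_int n" using assms unfolding limited_def by blast
  also have "(of_int n :: 'a) \<le> of_int (int (nat n))" unfolding of_int_le_iff by linarith
  also have "\<dots> = of_nat (nat n)" by (rule of_int_of_nat_eq)
  finally have "\<bar>x\<bar> \<in> \<int>" by (intro nonneg) auto
  then have "x \<in> \<int>" by (metis Ints_minus abs_if minus_minus)
  then show ?thesis using that by (auto elim: Ints_cases)
qed

end

section \<open>The galaxy obtained from an unlimited bound\<close>

theorem theorem1:
  assumes dickson: dickson_conjecture
    and elementary: "elementary_embedding (of_int :: int \<Rightarrow> 'a::linordered_idom)"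
    and proper: "(\<int> :: 'a set) \<noteq> UNIV"
  shows "(\<exists>(\<omega>::'a) (a :: 'a \<Rightarrow> int) (\<pi> :: 'a \<Rightarrow> 'a). \<omega> \<notin> \<int> \<and>
            (\<forall>s. limited s \<longrightarrow>
               \<omega> - s = of_int (a s) * \<pi> s \<and> fo_prime (\<pi> s) \<and> \<not> limited (\<pi> s))) \<and>
         (\<exists>(\<omega>::'a) (a :: 'a \<Rightarrow> int) (\<pi> :: 'a \<Rightarrow> 'a). \<omega> \<notin> \<int> \<and>
            (\<forall>s. limited s \<longrightarrow>
               \<omega> - s = of_int (a s) * \<pi> s \<and> fo_prime (\<pi> s) \<and> \<not> limited (\<pi> s)) \<and>
            (\<forall>s::int. a (of_int s) = galaxy_coeff s) \<and>
            {x \<in> galaxy \<omega>. fo_prime x} = {\<omega>} \<and> \<omega> = \<pi> 0)"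
proof -
  have limited_of_int: "limited (of_int i :: 'a)" for i
    unfolding limited_def by (rule exI[of _ "\<bar>i\<bar>"]) simp
  obtain x :: 'a where x: "x \<notin> \<int>" using proper by blast
  define N where "N = \<bar>x\<bar>"
  \<comment> \<open>Otherwise x would be limited, hence an integer.\<close>
  have N: "of_int n < N" for n
  proof (rule ccontr)
    assume "\<not> of_int n < N"
    then have "limited x" unfolding limited_def N_def by (auto simp: not_less)
    then show False using x by (auto elim: limited_imp_of_int[OF elementary])
  qed
  have unlimited: "\<not> limited y" if "N < y" for y
  proof
    assume "limited y"
    then obtain n where "\<bar>y\<bar> \<le> of_int n" unfolding limited_def by blast
    then have "y \<le> of_int n" by simp
    then show False using N[of n] that by simp
  qed
  have "sat (of_int \<circ> (\<lambda>_. 0) :: nat \<Rightarrow> 'a) galaxy_fm"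
    using elementary sat_galaxy_fm_int[OF dickson] by (rule sat_of_int)
  then have "\<exists>m>N. \<forall>s. 0 < s + (N + 1) \<longrightarrow> s < N + 1 \<longrightarrow>
      (\<exists>a. coeff_rel s a \<and> (\<exists>q>N. fo_prime q \<and> m = a * q + s))"
    unfolding sat_galaxy_fm by (rule spec)
  then obtain \<omega> where \<omega>: "N < \<omega>" "\<And>s. 0 < s + (N + 1) \<Longrightarrow> s < N + 1 \<Longrightarrow>
      \<exists>a. coeff_rel s a \<and> (\<exists>q>N. fo_prime q \<and> \<omega> = a * q + s)"
    by auto
  \<comment> \<open>Every standard i lies within the unlimited bound \<open>N\<close>, and by
    transfer the coefficient there is the standard a_i.\<close>
  have "\<exists>q. fo_prime q \<and> N < q \<and> \<omega> = of_int (galaxy_coeff i) * q + of_int i" for i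
  proof -
    have "of_int i < N + 1" using N[of i] by (simp add: less_le_trans)
    moreover have "0 < of_int i + (N + 1)" using N[of "- i"]
      by (simp add: add.assoc[symmetric] add_pos_pos)
    ultimately show ?thesis using \<omega>(2) coeff_rel_of_int[OF elementary] by blast
  qed
  then obtain q where q: "\<And>i. fo_prime (q i)" "\<And>i. N < q i"
      "\<And>i. \<omega> = of_int (galaxy_coeff i) * q i + of_int i" by metis
  \<comment> \<open>\<open>THE\<close> recovers the integer from its image, \<open>of_int\<close>
    being injective. Off the integers the value is unspecified, which is harmless because limited
    elements are integers.\<close>
  define a where "a s = galaxy_coeff (THE i. s = of_int i)" for s :: 'a
  define \<pi> where "\<pi> s = q (THE i. s = of_int i)" for s :: 'a
  have a_of_int: "a (of_int i) = galaxy_coeff i" for i by (simp add: a_def)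
  have \<pi>_of_int: "\<pi> (of_int i) = q i" for i by (simp add: \<pi>_def)
  have not_Int: "\<omega> \<notin> \<int>"
    using unlimited[OF \<omega>(1)] limited_of_int by (auto elim!: Ints_cases)
  have factor: "\<omega> - s = of_int (a s) * \<pi> s \<and> fo_prime (\<pi> s) \<and> \<not> limited (\<pi> s)"
    if lim: "limited s" for s
  proof -
    obtain i where i: "s = of_int i" using limited_imp_of_int[OF elementary lim] by blast
    show ?thesis using q(1)[of i] unlimited[OF q(2)[of i]] q(3)[of i]
      unfolding i a_of_int \<pi>_of_int by (simp add: algebra_simps)
  qed
  have \<omega>_eq: "\<omega> = \<pi> 0"
    using q(3)[of 0] \<pi>_of_int[of 0] by (simp add: galaxy_coeff_0)
  have "{x \<in> galaxy \<omega>. fo_prime x} = {\<omega>}"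
  proof (intro equalityI subsetI)
    fix x assume "x \<in> {x \<in> galaxy \<omega>. fo_prime x}"
    then obtain s where s: "x = \<omega> - s" "limited s" "fo_prime x" unfolding galaxy_def by blast
    obtain i where i: "s = of_int i" using limited_imp_of_int[OF elementary s(2)] by blast
    have x: "x = of_int (galaxy_coeff i) * q i" using q(3)[of i] s(1) i by simp
    \<comment> \<open>For i \<noteq> 0 both factors of a_i * q_i exceed 1, so the product is not
      prime.\<close>
    have "i = 0"
    proof (rule ccontr)
      assume "i \<noteq> 0"
      then have "1 < (of_int (galaxy_coeff i) :: 'a)" using galaxy_coeff_gt_1 by simp
      moreover have "1 < q i" using q(1)[of i] by (simp add: fo_prime_iff)
      ultimately show False using s(3) x unfolding fo_prime_iff by blast
    qed
    then show "x \<in> {\<omega>}" using s(1) i by simp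
  next
    fix x assume "x \<in> {\<omega>}"
    moreover have "\<omega> \<in> galaxy \<omega>"
      unfolding galaxy_def using limited_of_int[of 0] by (auto intro!: exI[of _ 0])
    moreover have "fo_prime \<omega>" using q(1)[of 0] \<pi>_of_int[of 0] \<omega>_eq by simp
    ultimately show "x \<in> {x \<in> galaxy \<omega>. fo_prime x}" by simp
  qed
  \<comment> \<open>The same \<omega>, a and \<pi> witness both conjuncts.\<close>
  then show ?thesis using not_Int factor a_of_int \<omega>_eq by blast
qed

end
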